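(* Consider the Diophantine equation $xy = z^2$ in positive integers $x, y, z$. A triple $(x,y,z)$ of positive integers is a solution of this equation if and only if there exist positive integers $\delta, p_1, p_2$ with $\gcd(p_1,p_2)=1$ such that $$x = \delta\, p_1^2,\qquad y = \delta\, p_2^2,\qquad z = \delta\, p_1 p_2 .$$ *)

theory Defs
  imports Main
begin

end

(* Write x / z in lowest terms as a / b, so x = g a and z = g b with g = gcd x z.
   Then x y = z^2 becomes a y = g b^2, and coprimality forces a to divide g; the
   cofactor is \<delta>, and (p1, p2) = (a, b). *)
theory Submission
  imports Defs
begin

theorem theorem2:
  fixes x y z :: int
  assumes "x > 0" and "y > 0" and "z > 0"
  shows "x * y = z ^ 2 \<longleftrightarrow>
    (\<exists>\<delta> p\<^sub>1 p\<^sub>2 :: int. \<delta> > 0 \<and> p\<^sub>1 > 0 \<and> p\<^sub>2 > 0 \<and> gcd p\<^sub>1 p\<^sub>2 = 1 \<and>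
      x = \<delta> * p\<^sub>1 ^ 2 \<and> y = \<delta> * p\<^sub>2 ^ 2 \<and> z = \<delta> * p\<^sub>1 * p\<^sub>2)"
    (is "?L \<longleftrightarrow> ?R")
proof
  assume L: ?L
  define g where "g = gcd x z"
  have g: "g > 0" using assms by (simp add: g_def)
  \<comment> \<open>\<open>g > 0\<close> gives the nonzero gcd that
    \<open>gcd_coprime_exists\<close> requires.\<close>
  obtain a b where ab: "x = a * g" "z = b * g" "coprime a b"
    using gcd_coprime_exists[of x z] g unfolding g_def by (metis less_irrefl)
  have pos: "a > 0" "b > 0" using ab assms g by (simp_all add: zero_less_mult_iff)
  have "g * (a * y) = g * (g * b ^ 2)"
    using L by (simp add: ab power2_eq_square mult_ac)
  then have ay: "a * y = g * b ^ 2" using g by simp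
  then have "a dvd g * b ^ 2" by (metis dvd_triv_left)
  then have "a dvd g" using ab(3) by (simp add: coprime_dvd_mult_left_iff)
  then obtain d where d: "g = a * d" ..
  have "d > 0" using d g pos by (simp add: zero_less_mult_iff)
  moreover have "a * y = a * (d * b ^ 2)" using ay d by (simp add: mult_ac)
  then have "y = d * b ^ 2" using pos by simp
  \<comment> \<open>Substituting \<open>g = a * d\<close> turns \<open>x = a * g\<close> into
    \<open>d * a ^ 2\<close> and \<open>z = b * g\<close> into \<open>d * a * b\<close>.\<close>
  ultimately show ?R
    using pos ab d
    by (intro exI[of _ d] exI[of _ a] exI[of _ b]) (simp add: power2_eq_square mult_ac)
next
  assume ?R
  \<comment> \<open>Both sides expand to the square of
    \<open>\<delta> * p\<^sub>1 * p\<^sub>2\<close>.\<close>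
  then show ?L by (auto simp: power2_eq_square mult_ac)
qed

end
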